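(* Let $n\ge 2$, let $x=(x_1,\dots,x_n)\in\mathbb{R}^n$ be a deterministic vector not collinear with $(1,\dots,1)^T$, let $\theta>0$ and $\beta=(\beta_0,\beta_1)^T\in\mathbb{R}^2$, and let $\epsilon_1,\dots,\epsilon_n$ be independent random variables, each uniformly distributed on $[-\theta,\theta]$. Let $Y=X\beta+\epsilon$ with $X=[1,x]$, and let $\hat\beta=(\hat\beta_0,\hat\beta_1)^T=(X^TX)^{-1}X^TY$ be the least square estimator. Put $S_1=\sum_{i=1}^n x_i$, $S_2=\sum_{i=1}^n x_i^2$, $d=nS_2-S_1^2$, and for $1\le k\le n$ put $p_k=S_2-x_kS_1$ and $p'_k=nx_k-S_1$. For $q=(q_1,\dots,q_n)\in(\mathbb{R}\setminus\{0\})^n$ define $$g_q(w)=\frac{1}{2\left(\prod_{k=1}^n q_k\right)\theta^{n}(n-1)!}\sum_{k=0}^{n}(-1)^{k}\sum_{l=1}^{n_k}\left(\frac{w}{2}+\theta\,\frac{\sum_{i=1}^n q_i}{2}-\theta\,S_{nkl}(q)\right)_{+}^{n-1},\qquad w\in\mathbb{R}.$$ If $p_k\neq 0$ for all $k$, then $\hat\beta_0$ has probability density function $$f_{\hat\beta_0}(t)=d\,g_{p}\big(d(t-\beta_0)\big),\qquad p=(p_1,\dots,p_n).$$ If $p'_k\neq 0$ for all $k$, then $\hat\beta_1$ has probability density function $$f_{\hat\beta_1}(t)=d\,g_{p'}\big(d(t-\beta_1)\big),\qquad p'=(p'_1,\dots,p'_n).$$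
   Context: $X=[1,x]$ denotes the $n\times 2$ matrix whose first column is $(1,\dots,1)^T$ and whose second column is $x$; $Y=(Y_1,\dots,Y_n)^T$ and $\epsilon=(\epsilon_1,\dots,\epsilon_n)^T$. For $0\le k\le n$, $n_k=\binom{n}{k}$ is the number of $k$-element subsets of $\{1,\dots,n\}$; enumerating these subsets as $I_{k,1},\dots,I_{k,n_k}$, one sets $S_{nkl}(q)=\sum_{i\in I_{k,l}}q_i$ (so for $k=0$ the only sum is $0$). Also $y_+=\max(0,y)$. *)

theory Defs
  imports "HOL-Probability.Probability"
begin

definition design_matrix :: "real ^ 'n \<Rightarrow> real ^ 2 ^ 'n" where
  "design_matrix x = (\<chi> i. vector [1, x $ i])"

definition least_square_estimator :: "real ^ 2 ^ 'n \<Rightarrow> real ^ 'n \<Rightarrow> real ^ 2" where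
  "least_square_estimator X Y = (matrix_inv (transpose X ** X) ** transpose X) *v Y"

definition S1 :: "real ^ 'n \<Rightarrow> real" where
  "S1 x = (\<Sum>i\<in>UNIV. x $ i)"

definition S2 :: "real ^ 'n \<Rightarrow> real" where
  "S2 x = (\<Sum>i\<in>UNIV. (x $ i)\<^sup>2)"

definition d_coeff :: "real ^ 'n \<Rightarrow> real" where
  "d_coeff x = real CARD('n) * S2 x - (S1 x)\<^sup>2"

definition p_coeff :: "real ^ 'n \<Rightarrow> real ^ 'n" where
  "p_coeff x = (\<chi> k. S2 x - x $ k * S1 x)"

definition p'_coeff :: "real ^ 'n \<Rightarrow> real ^ 'n" where
  "p'_coeff x = (\<chi> k. real CARD('n) * x $ k - S1 x)"

definition pos_part :: "real \<Rightarrow> real" where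
  "pos_part y = max 0 y"

(* The k-element subsets I of the index type play the role of I_{k,1}, ..., I_{k,n_k};
   S_{nkl}(q) is then the sum of q over I. *)
definition g_dens :: "real \<Rightarrow> real ^ 'n \<Rightarrow> real \<Rightarrow> real" where
  "g_dens \<theta> q w =
     1 / (2 * (\<Prod>k\<in>UNIV. q $ k) * \<theta> ^ CARD('n) * fact (CARD('n) - 1)) *
     (\<Sum>k = 0..CARD('n). (-1) ^ k *
       (\<Sum>I | I \<subseteq> (UNIV :: 'n set) \<and> card I = k.
          pos_part (w / 2 + \<theta> * ((\<Sum>i\<in>UNIV. q $ i) / 2) - \<theta> * (\<Sum>i\<in>I. q $ i))
            ^ (CARD('n) - 1)))"

(* Nonnegativity is required explicitly because ennreal truncates negative values to 0. *)
definition has_pdf :: "'a measure \<Rightarrow> ('a \<Rightarrow> real) \<Rightarrow> (real \<Rightarrow> real) \<Rightarrow> bool" where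
  "has_pdf M Z f \<longleftrightarrow> (\<forall>t. 0 \<le> f t) \<and> distributed M lborel Z (\<lambda>t. ennreal (f t))"

end

theory Submission
  imports Defs
begin

text \<open>
  The error of the estimator is a linear combination of the independent variables \<open>\<epsilon>\<^sub>i\<close>.
  Truncated powers \<open>y\<^sub>+\<^sup>m / m!\<close> are successive antiderivatives of one another, so convolving a
  signed combination of shifted truncated powers with one more uniform density raises the exponent
  by one and replaces each shift by a signed pair of shifts. The coefficients may have either
  sign throughout: replacing a coefficient by its negative exchanges the members of each pair and
  flips the sign of the normalising product.
\<close>

section \<open>Truncated powers and their antiderivatives\<close>

text \<open>The case distinction matters for exponent 0: \<open>max 0 y ^ 0\<close> is 1 everywhere
  because \<open>0 ^ 0 = 1\<close>, whereas the uniform density needs the unit step, here with value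
  0 at the origin.\<close>

definition truncated_power :: "nat \<Rightarrow> real \<Rightarrow> real" where
  "truncated_power m y = (if 0 < y then y ^ m / fact m else 0)"

lemma truncated_power_measurable [measurable]: "truncated_power m \<in> borel_measurable borel"
  unfolding truncated_power_def by measurable

lemma truncated_power_Suc: "truncated_power (Suc m) y = max 0 y ^ Suc m / fact (Suc m)"
  by (simp add: truncated_power_def max_def)

lemma continuous_on_truncated_power_Suc [continuous_intros]:
  "continuous_on A f \<Longrightarrow> continuous_on A (\<lambda>y. truncated_power (Suc m) (f y))"
  unfolding truncated_power_Suc by (intro continuous_intros) auto

text \<open>On each open half line the function is a monomial or zero. At the origin
  \<open>truncated_power 1\<close> has a kink, so that point is left out; a single point does not
  affect the integrals.\<close>

lemma has_derivative_truncated_power: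
  assumes "y \<noteq> 0"
  shows "(truncated_power (Suc m) has_real_derivative truncated_power m y) (at y)"
proof (cases "y > 0")
  case True
  have "((\<lambda>y. y ^ Suc m / fact (Suc m)) has_real_derivative (real (Suc m) * y ^ m) / fact (Suc m)) (at y)"
    by (rule derivative_eq_intros refl | simp)+
  moreover have "(real (Suc m) * y ^ m) / fact (Suc m) = truncated_power m y"
    using True by (simp add: truncated_power_def field_simps del: of_nat_Suc)
  ultimately have "((\<lambda>y. y ^ Suc m / fact (Suc m)) has_real_derivative truncated_power m y) (at y)"
    by simp
  then show ?thesis
    by (rule has_field_derivative_transform_within_open[of _ _ _ "{0<..}"])
       (use True in \<open>auto simp: truncated_power_def\<close>)
next
  case False
  have "((\<lambda>y. 0) has_real_derivative truncated_power m y) (at y)"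
    using False by (simp add: truncated_power_def)
  then show ?thesis
    by (rule has_field_derivative_transform_within_open[of _ _ _ "{..<0}"])
       (use False assms in \<open>auto simp: truncated_power_def\<close>)
qed

text \<open>Dividing the antiderivative by the signed \<open>q\<close>, not by its absolute value,
  makes one formula serve both signs.\<close>

lemma has_integral_truncated_power:
  assumes "q \<noteq> 0" "0 \<le> \<theta>"
  shows "((\<lambda>u. truncated_power m (c - q * u)) has_integral
    (truncated_power (Suc m) (c + \<theta> * q) - truncated_power (Suc m) (c - \<theta> * q)) / q) {-\<theta>..\<theta>}"
proof -
  let ?F = "\<lambda>u. - truncated_power (Suc m) (c - q * u) / q"
  have "((\<lambda>u. truncated_power m (c - q * u)) has_integral ?F \<theta> - ?F (-\<theta>)) {-\<theta>..\<theta>}"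
  \<comment> \<open>\<open>c / q\<close> is the zero of \<open>c - q * u\<close>, the only point
    where differentiability may fail; continuity of \<open>?F\<close> is enough there.\<close>
  proof (rule fundamental_theorem_of_calculus_interior_strong[of "{c / q}"])
    fix u assume "u \<in> {-\<theta><..<\<theta>} - {c / q}"
    then have "c - q * u \<noteq> 0"
      using assms by (auto simp: field_simps)
    then have "((\<lambda>u. truncated_power (Suc m) (c - q * u)) has_real_derivative
        truncated_power m (c - q * u) * (- q)) (at u)"
      by (intro DERIV_chain2[OF has_derivative_truncated_power]) (auto intro!: derivative_eq_intros)
    then have "(?F has_real_derivative - (truncated_power m (c - q * u) * (- q)) / q) (at u)"
      by (intro DERIV_cdivide DERIV_minus)
    then show "(?F has_vector_derivative truncated_power m (c - q * u)) (at u)"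
      using assms by (simp add: has_real_derivative_iff_has_vector_derivative)
  qed (use assms in \<open>auto intro!: continuous_intros\<close>)
  moreover have "?F \<theta> - ?F (-\<theta>) =
      (truncated_power (Suc m) (c + \<theta> * q) - truncated_power (Suc m) (c - \<theta> * q)) / q"
    by (simp add: diff_divide_distrib mult.commute)
  ultimately show ?thesis by simp
qed

section \<open>The density of a weighted sum and its recursion\<close>

text \<open>For nonempty finite \<open>A\<close>, nonzero \<open>q\<close> and
  \<open>\<theta> > 0\<close> this is the density of the sum of \<open>q i * U i\<close> with
  independent \<open>U i\<close> uniform on \<open>{-\<theta>..\<theta>}\<close>. Each
  \<open>I\<close> stands for a vertex of the box: its shift is \<open>\<theta>\<close> times the
  sum of the \<open>q i\<close>, taken with a minus sign on \<open>I\<close>. A general index set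
  allows induction by inserting one index.\<close>

definition box_density :: "real \<Rightarrow> ('i \<Rightarrow> real) \<Rightarrow> 'i set \<Rightarrow> real \<Rightarrow> real" where
  "box_density \<theta> q A w =
     (\<Sum>I\<in>Pow A. (-1) ^ card I *
        truncated_power (card A - 1) (w + \<theta> * (\<Sum>i\<in>A. q i) - 2 * \<theta> * (\<Sum>i\<in>I. q i)))
     / (\<Prod>i\<in>A. 2 * \<theta> * q i)"

lemma box_density_measurable [measurable]: "box_density \<theta> q A \<in> borel_measurable borel"
  unfolding box_density_def by measurable

text \<open>Integrating each truncated power produces two terms for every \<open>I\<close>; they are
  the terms of \<open>I\<close> and \<open>insert j I\<close> in the larger sum.\<close>

lemma has_integral_box_density:
  assumes A: "finite A" "A \<noteq> {}" "j \<notin> A" and q: "q j \<noteq> 0" and \<theta>: "\<theta> > 0"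
  shows "((\<lambda>u. box_density \<theta> q A (w - q j * u) / (2 * \<theta>)) has_integral
    box_density \<theta> q (insert j A) w) {-\<theta>..\<theta>}"
proof -
  define m where "m = card A - 1"
  \<comment> \<open>Since \<open>A\<close> is nonempty, the subtraction does not truncate, and
    inserting \<open>j\<close> raises the exponent by exactly one.\<close>
  have m: "card A - 1 = m" "card (insert j A) - 1 = Suc m"
    using A card_gt_0_iff[of A] by (auto simp: m_def)
  let ?H = truncated_power
  let ?c = "\<lambda>I. w + \<theta> * (\<Sum>i\<in>A. q i) - 2 * \<theta> * (\<Sum>i\<in>I. q i)"
  let ?P = "\<Prod>i\<in>A. 2 * \<theta> * q i"
  let ?f = "\<lambda>I. (-1) ^ card I * ?H (Suc m)
      (w + \<theta> * (\<Sum>i\<in>insert j A. q i) - 2 * \<theta> * (\<Sum>i\<in>I. q i))"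
  have "((\<lambda>u. (\<Sum>I\<in>Pow A. (-1) ^ card I * ?H m (?c I - q j * u)) / (?P * (2 * \<theta>))) has_integral
      (\<Sum>I\<in>Pow A. (-1) ^ card I * ((?H (Suc m) (?c I + \<theta> * q j) - ?H (Suc m) (?c I - \<theta> * q j)) / q j))
        / (?P * (2 * \<theta>))) {-\<theta>..\<theta>}"
    using A \<theta> q by (intro has_integral_divide has_integral_sum has_integral_mult_right
        has_integral_truncated_power) auto
  moreover have "(\<Sum>I\<in>Pow A. (-1) ^ card I * ?H m (?c I - q j * u)) / (?P * (2 * \<theta>)) =
      box_density \<theta> q A (w - q j * u) / (2 * \<theta>)" for u
    unfolding box_density_def m by (simp add: algebra_simps)
  moreover have "(\<Sum>I\<in>Pow A. (-1) ^ card I *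
        ((?H (Suc m) (?c I + \<theta> * q j) - ?H (Suc m) (?c I - \<theta> * q j)) / q j)) / (?P * (2 * \<theta>))
      = box_density \<theta> q (insert j A) w"
  proof -
    have fin: "finite I" "j \<notin> I" if "I \<in> Pow A" for I
      using that A by (auto intro: finite_subset)
    have "sum ?f (Pow (insert j A)) = sum ?f (Pow A) + sum ?f (insert j ` Pow A)"
      unfolding Pow_insert by (rule sum.union_disjoint) (use A in auto)
    also have "sum ?f (insert j ` Pow A) = (\<Sum>I\<in>Pow A. ?f (insert j I))"
      by (subst sum.reindex) (use A in \<open>auto simp: inj_on_def\<close>)
    \<comment> \<open>Adding \<open>j\<close> to \<open>I\<close> lowers the argument by
      \<open>2 * \<theta> * q j\<close>, which turns \<open>+ \<theta> * q j\<close> into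
      \<open>- \<theta> * q j\<close>, and flips the sign through \<open>card\<close>.\<close>
    also have "\<dots> = (\<Sum>I\<in>Pow A. - ((-1) ^ card I * ?H (Suc m) (?c I - \<theta> * q j)))"
      using A fin by (intro sum.cong) (auto simp: algebra_simps)
    also have "sum ?f (Pow A) = (\<Sum>I\<in>Pow A. (-1) ^ card I * ?H (Suc m) (?c I + \<theta> * q j))"
      using A by (intro sum.cong) (auto simp: algebra_simps)
    finally have "sum ?f (Pow (insert j A)) = (\<Sum>I\<in>Pow A. (-1) ^ card I *
        (?H (Suc m) (?c I + \<theta> * q j) - ?H (Suc m) (?c I - \<theta> * q j)))"
      by (simp add: sum.distrib[symmetric] right_diff_distrib)
    moreover have "(\<Prod>i\<in>insert j A. 2 * \<theta> * q i) = q j * (?P * (2 * \<theta>))"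
      using A by simp
    ultimately show ?thesis
      by (simp only: box_density_def m times_divide_eq_right sum_divide_distrib[symmetric]
          divide_divide_eq_left)
  qed
  ultimately show ?thesis by simp
qed

lemma box_density_singleton:
  "box_density \<theta> q {j} w =
    (truncated_power 0 (w + \<theta> * q j) - truncated_power 0 (w - \<theta> * q j)) / (2 * \<theta> * q j)"
proof -
  have Pow: "Pow {j} = {{}, {j}}" by auto
  show ?thesis by (simp add: box_density_def Pow algebra_simps)
qed

text \<open>The alternating sum hides its sign, but the recursion writes it as an average of the
  density for a smaller set. For one index the numerator, where nonzero, has the sign of
  \<open>q j\<close>.\<close>

lemma box_density_nonneg:
  assumes "finite A" "A \<noteq> {}" "\<And>i. i \<in> A \<Longrightarrow> q i \<noteq> 0" "\<theta> > 0"
  shows "0 \<le> box_density \<theta> q A w"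
  using assms
proof (induction A arbitrary: w rule: finite_ne_induct)
  case (singleton j)
  then have "\<theta> * q j > 0 \<or> \<theta> * q j < 0"
    by (auto simp: zero_less_mult_iff mult_less_0_iff)
  then show ?case
    by (auto simp: box_density_singleton truncated_power_def divide_le_0_iff zero_le_divide_iff
        mult_less_0_iff zero_less_mult_iff)
next
  case (insert j A)
  show ?case
  proof (rule has_integral_nonneg[OF has_integral_box_density])
    fix u show "0 \<le> box_density \<theta> q A (w - q j * u) / (2 * \<theta>)"
      using insert by simp
  qed (use insert in auto)
qed

section \<open>Laws of weighted sums of uniform variables\<close>

lemma (in prob_space) distributed_uniform_scaled:
  fixes X :: "'a \<Rightarrow> real"
  assumes [measurable]: "random_variable borel X"
    and X: "distr M borel X = uniform_measure lborel {-\<theta>..\<theta>}" and \<theta>: "\<theta> > 0" and q: "q \<noteq> 0"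
  shows "distributed M lborel (\<lambda>\<omega>. q * X \<omega>)
    (\<lambda>y. ennreal (indicator {-\<theta>..\<theta>} (y / q) / (2 * \<theta>) / \<bar>q\<bar>))"
proof -
  have "distr M lborel X = distr M borel X"
    by (rule distr_cong) auto
  also have "\<dots> = density lborel (\<lambda>y. ennreal (indicator {-\<theta>..\<theta>} y / (2 * \<theta>)))"
    unfolding X uniform_measure_def using \<theta>
    by (intro density_cong) (auto split: split_indicator simp: divide_ennreal[symmetric] ennreal_1[symmetric] simp del: ennreal_1)
  finally have "distributed M lborel X (\<lambda>y. ennreal (indicator {-\<theta>..\<theta>} y / (2 * \<theta>)))"
    by (simp add: distributed_def)
  from distributed_affine[OF this q, of 0] show ?thesis
    using q \<theta> by (simp add: divide_ennreal)
qed

text \<open>\<open>indep_vars_sum\<close> puts the single summand first, while the convolution below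
  integrates over that summand and wants it second.\<close>

lemma (in prob_space) indep_var_swap:
  assumes "indep_var S X T Y"
  shows "indep_var T Y S X"
proof -
  have "indep_set B A" if "indep_set A B" for A B
    using that unfolding indep_sets2_eq by (metis Int_commute mult.commute)
  then show ?thesis
    using assms unfolding indep_var_eq by auto
qed

lemma (in prob_space) distributed_sum_uniform:
  fixes X :: "'i \<Rightarrow> 'a \<Rightarrow> real"
  assumes "finite A" "A \<noteq> {}" "indep_vars (\<lambda>_. borel) X A"
    and "\<And>i. i \<in> A \<Longrightarrow> distr M borel (X i) = uniform_measure lborel {-\<theta>..\<theta>}"
    and "\<And>i. i \<in> A \<Longrightarrow> q i \<noteq> 0" and "\<theta> > 0"
  shows "distributed M lborel (\<lambda>\<omega>. \<Sum>i\<in>A. q i * X i \<omega>) (\<lambda>w. ennreal (box_density \<theta> q A w))"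
  using assms
proof (induction A rule: finite_ne_induct)
  case (singleton j)
  have rv: "random_variable borel (X j)"
    using singleton by (auto simp: indep_vars_def)
  have q: "q j \<noteq> 0" using singleton by auto
  let ?e = "\<lambda>y. indicator {-\<theta>..\<theta>} (y / q j) / (2 * \<theta>) / \<bar>q j\<bar> :: real"
  have D: "distributed M lborel (\<lambda>\<omega>. q j * X j \<omega>) (\<lambda>y. ennreal (?e y))"
    by (rule distributed_uniform_scaled) (use singleton rv in auto)
  \<comment> \<open>The two densities disagree at one end point of the interval, where the truncated powers of
    exponent 0 jump.\<close>
  have ae: "AE y in lborel. y \<noteq> \<theta> * q j \<and> y \<noteq> - (\<theta> * q j)"
    by (intro AE_conjI AE_lborel_singleton)
  have eq: "?e y = box_density \<theta> q {j} y" if "y \<noteq> \<theta> * q j" "y \<noteq> - (\<theta> * q j)" for y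
  proof (cases "q j > 0")
    case True
    define c where "c = \<theta> * q j"
    have "c > 0" using True \<open>\<theta> > 0\<close> by (simp add: c_def)
    moreover have "y / q j \<in> {-\<theta>..\<theta>} \<longleftrightarrow> -c \<le> y \<and> y \<le> c"
      using True by (auto simp: c_def field_simps)
    ultimately show ?thesis using that True
      by (simp add: box_density_singleton truncated_power_def indicator_def flip: c_def)
  next
    case False
    define c where "c = \<theta> * q j"
    have q: "q j < 0" using False q by simp
    then have "c < 0" using \<open>\<theta> > 0\<close> by (simp add: c_def mult_less_0_iff)
    moreover have "y / q j \<in> {-\<theta>..\<theta>} \<longleftrightarrow> c \<le> y \<and> y \<le> -c"
      using q by (auto simp: c_def field_simps)
    ultimately show ?thesis using that q
      by (simp add: box_density_singleton truncated_power_def indicator_def flip: c_def)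
  qed
  have "density lborel (\<lambda>y. ennreal (?e y)) = density lborel (\<lambda>y. ennreal (box_density \<theta> q {j} y))"
    proof (rule density_cong)
    show "AE y in lborel. ennreal (?e y) = ennreal (box_density \<theta> q {j} y)"
      using ae by (rule eventually_mono) (metis eq)
  qed simp_all
  with D show ?case
    by (simp add: distributed_def)
next
  case (insert j A)
  have q: "q j \<noteq> 0" using insert by auto
  have rv: "random_variable borel (X j)"
    using insert by (auto simp: indep_vars_def)
  let ?e = "\<lambda>y. indicator {-\<theta>..\<theta>} (y / q j) / (2 * \<theta>) / \<bar>q j\<bar> :: real"
  have "indep_vars (\<lambda>_. borel) (\<lambda>i \<omega>. q i * X i \<omega>) (insert j A)"
    by (rule indep_vars_compose2[OF insert.prems(1)]) simp
  then have "indep_var borel (\<lambda>\<omega>. q j * X j \<omega>) borel (\<lambda>\<omega>. \<Sum>i\<in>A. q i * X i \<omega>)"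
    using insert by (intro indep_vars_sum) auto
  then have ind: "indep_var borel (\<lambda>\<omega>. \<Sum>i\<in>A. q i * X i \<omega>) borel (\<lambda>\<omega>. q j * X j \<omega>)"
    by (rule indep_var_swap)
  have IH: "distributed M lborel (\<lambda>\<omega>. \<Sum>i\<in>A. q i * X i \<omega>) (\<lambda>w. ennreal (box_density \<theta> q A w))"
    using insert.prems by (intro insert.IH) (auto intro: indep_vars_subset)
  have D: "distributed M lborel (\<lambda>\<omega>. q j * X j \<omega>) (\<lambda>y. ennreal (?e y))"
    by (rule distributed_uniform_scaled) (use insert rv in auto)
  have conv: "(\<integral>\<^sup>+y. ennreal (box_density \<theta> q A (w - y)) * ennreal (?e y) \<partial>lborel) =
      ennreal (box_density \<theta> q (insert j A) w)" for w
  proof -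
    \<comment> \<open>Nonnegativity lets the \<open>ennreal\<close> factors merge into one and turns
      the real integral of the recursion into a nonnegative one.\<close>
    have nonneg: "0 \<le> box_density \<theta> q A v" for v
      using insert by (intro box_density_nonneg) auto
    \<comment> \<open>Substituting \<open>y = q j * u\<close> gives a Jacobian that cancels the
      factor \<open>1 / \<bar>q j\<bar>\<close> of \<open>?e\<close>, leaving the integrand of
      \<open>has_integral_box_density\<close>.\<close>
    have "(\<integral>\<^sup>+y. ennreal (box_density \<theta> q A (w - y)) * ennreal (?e y) \<partial>lborel) =
        \<bar>q j\<bar> * (\<integral>\<^sup>+u. ennreal (box_density \<theta> q A (w - q j * u)) * ennreal (?e (q j * u)) \<partial>lborel)"
      using nn_integral_real_affine[of "\<lambda>y. ennreal (box_density \<theta> q A (w - y)) * ennreal (?e y)" "q j" 0] q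
      by simp
    also have "\<dots> = (\<integral>\<^sup>+u. \<bar>q j\<bar> * (ennreal (box_density \<theta> q A (w - q j * u)) * ennreal (?e (q j * u))) \<partial>lborel)"
      by (rule nn_integral_cmult[symmetric]) measurable
    also have "\<dots> = (\<integral>\<^sup>+u. ennreal (indicator {-\<theta>..\<theta>} u * (box_density \<theta> q A (w - q j * u) / (2 * \<theta>))) \<partial>lborel)"
      using q nonneg \<open>\<theta> > 0\<close>
      by (intro nn_integral_cong) (auto simp: ennreal_mult'[symmetric] split: split_indicator)
    also have "\<dots> = ennreal (box_density \<theta> q (insert j A) w)"
      using insert nonneg q by (intro nn_integral_has_integral_lebesgue has_integral_box_density) auto
    finally show ?thesis .
  qed
  show ?case
    using distributed_convolution[OF ind IH D, unfolded conv] insert.hyps by (simp add: add.commute)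
qed

section \<open>Identification with the stated formula\<close>

text \<open>Taking the factor 1/2 out of each positive part yields \<open>2 ^ (n - 1)\<close>, which
  joins the leading 2 to form the product of the \<open>2 * \<theta> * q $ i\<close>. With
  \<open>n \<ge> 2\<close> the exponent is positive, so powers of \<open>pos_part\<close> are
  truncated powers even at 0.\<close>

lemma g_dens_eq_box_density:
  fixes q :: "real ^ 'n"
  assumes "CARD('n) \<ge> 2"
  shows "g_dens \<theta> q w = box_density \<theta> (\<lambda>i. q $ i) UNIV w"
proof -
  define m where "m = CARD('n) - 2"
  have n: "CARD('n) = Suc (Suc m)" using assms by (simp add: m_def)
  let ?v = "\<lambda>I. w + \<theta> * (\<Sum>i\<in>UNIV. q $ i) - 2 * \<theta> * (\<Sum>i\<in>I. q $ i)"
  let ?p = "\<lambda>I. pos_part (w / 2 + \<theta> * ((\<Sum>i\<in>UNIV. q $ i) / 2) - \<theta> * (\<Sum>i\<in>I. q $ i)) ^ (CARD('n) - 1)"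
  have p: "?p I = truncated_power (Suc m) (?v I) * fact (Suc m) / 2 ^ Suc m" for I
  proof -
    have "pos_part (w / 2 + \<theta> * ((\<Sum>i\<in>UNIV. q $ i) / 2) - \<theta> * (\<Sum>i\<in>I. q $ i)) = max 0 (?v I) / 2"
      by (simp add: pos_part_def max_def field_simps)
    then have "?p I = (max 0 (?v I) / 2) ^ Suc m"
      by (simp only: n diff_Suc_1)
    then show ?thesis
      by (simp only: truncated_power_Suc power_divide) (simp del: power_Suc fact_Suc)
  qed
  have "(\<Sum>k = 0..CARD('n). (-1) ^ k * (\<Sum>I | I \<subseteq> (UNIV :: 'n set) \<and> card I = k. ?p I)) =
      (\<Sum>k = 0..CARD('n). \<Sum>I | I \<in> Pow (UNIV :: 'n set) \<and> card I = k. (-1) ^ card I * ?p I)"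
    by (auto simp: sum_distrib_left intro!: sum.cong)
  \<comment> \<open>The outer sum over \<open>k\<close> merely sorts the subsets by
    cardinality.\<close>
  also have "\<dots> = (\<Sum>I\<in>Pow (UNIV :: 'n set). (-1) ^ card I * ?p I)"
    by (rule sum.group) (auto intro!: card_mono)
  also have "\<dots> = (\<Sum>I\<in>Pow (UNIV :: 'n set). (-1) ^ card I * truncated_power (Suc m) (?v I))
      * fact (Suc m) / 2 ^ Suc m"
    unfolding p by (simp only: sum_distrib_right sum_divide_distrib times_divide_eq_right mult.assoc)
  finally have sum: "(\<Sum>k = 0..CARD('n). (-1) ^ k * (\<Sum>I | I \<subseteq> (UNIV :: 'n set) \<and> card I = k. ?p I)) =
      (\<Sum>I\<in>Pow (UNIV :: 'n set). (-1) ^ card I * truncated_power (Suc m) (?v I))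
      * fact (Suc m) / 2 ^ Suc m" .
  have prod: "(\<Prod>i\<in>(UNIV :: 'n set). 2 * \<theta> * q $ i) = 2 * 2 ^ Suc m * \<theta> ^ CARD('n) * (\<Prod>i\<in>UNIV. q $ i)"
    by (simp add: prod.distrib n)
  have card: "CARD('n) - 1 = Suc m" by (simp add: n)
  show ?thesis
    unfolding g_dens_def box_density_def sum prod unfolding card
    by (simp add: field_simps del: fact_Suc power_Suc)
qed

section \<open>Algebra of the least square estimator\<close>

text \<open>\<open>d_coeff x\<close> is the Gram determinant of \<open>x\<close> and the all-ones
  vector, so this is the strict Cauchy-Schwarz inequality.\<close>

lemma d_coeff_pos:
  fixes x :: "real ^ 'n"
  assumes "\<not> collinear {0, x, (\<chi> i. 1)}"
  shows "d_coeff x > 0"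
proof -
  let ?u = "(\<chi> i. 1) :: real ^ 'n"
  have "\<bar>x \<bullet> ?u\<bar> < norm x * norm ?u"
    using assms norm_cauchy_schwarz_equal[of x ?u] Cauchy_Schwarz_ineq2[of x ?u] by linarith
  then have "\<bar>x \<bullet> ?u\<bar>\<^sup>2 < (norm x * norm ?u)\<^sup>2"
    by (intro power_strict_mono) auto
  then have "(x \<bullet> ?u)\<^sup>2 < (x \<bullet> x) * (?u \<bullet> ?u)"
    by (simp add: power_mult_distrib power2_norm_eq_inner)
  then show ?thesis
    by (simp add: d_coeff_def S1_def S2_def inner_vec_def power2_eq_square mult.commute)
qed

text \<open>Working with the normal equations for the error \<open>b\<close> avoids writing out the
  inverse of the Gram matrix.\<close>

lemma least_square_estimator_normal_equations:
  fixes x e :: "real ^ 'n" and \<beta> :: "real ^ 2"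
  assumes d: "d_coeff x \<noteq> 0"
  defines "b \<equiv> least_square_estimator (design_matrix x) (design_matrix x *v \<beta> + e) - \<beta>"
  shows "real CARD('n) * b $ 1 + S1 x * b $ 2 = (\<Sum>i\<in>UNIV. e $ i)"
    and "S1 x * b $ 1 + S2 x * b $ 2 = (\<Sum>i\<in>UNIV. x $ i * e $ i)"
proof -
  let ?X = "design_matrix x"
  let ?G = "transpose ?X ** ?X"
  have X: "?X $ i $ 1 = 1" "?X $ i $ 2 = x $ i" for i
    by (simp_all add: design_matrix_def)
  have G: "?G $ 1 $ 1 = real CARD('n)" "?G $ 1 $ 2 = S1 x" "?G $ 2 $ 1 = S1 x" "?G $ 2 $ 2 = S2 x"
    by (simp_all add: matrix_matrix_mult_def transpose_def X S1_def S2_def power2_eq_square)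
  have "det ?G = d_coeff x"
    by (simp add: det_2 G d_coeff_def power2_eq_square)
  then have "invertible ?G"
    using d by (simp add: invertible_det_nz)
  \<comment> \<open>\<open>matrix_inv\<close> is a choice term, so invertibility is what makes it an
    actual inverse.\<close>
  then have inv: "?G ** matrix_inv ?G = mat 1"
    unfolding invertible_def matrix_inv_def by (rule someI2_ex) simp
  have "?G *v least_square_estimator ?X y = transpose ?X *v y" for y
    by (simp add: least_square_estimator_def matrix_vector_mul_assoc matrix_mul_assoc inv
        del: transpose_matrix_vector)
  \<comment> \<open>Taking \<open>y\<close> to be the observed vector, the contribution
    \<open>?G *v \<beta>\<close> cancels.\<close>
  then have "?G *v b = transpose ?X *v e"
    by (simp add: b_def matrix_vector_mult_diff_distrib matrix_vector_right_distrib
        matrix_vector_mul_assoc del: transpose_matrix_vector)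
  then have "(?G *v b) $ 1 = (transpose ?X *v e) $ 1" "(?G *v b) $ 2 = (transpose ?X *v e) $ 2"
    by simp_all
  then show "real CARD('n) * b $ 1 + S1 x * b $ 2 = (\<Sum>i\<in>UNIV. e $ i)"
    and "S1 x * b $ 1 + S2 x * b $ 2 = (\<Sum>i\<in>UNIV. x $ i * e $ i)"
    unfolding matrix_vector_mult_def by (simp_all add: sum_2 G) (simp_all add: transpose_def X)
qed

text \<open>Cramer's rule: eliminating one unknown from the two normal equations leaves
  \<open>d_coeff x\<close> times the other, and the weights of the \<open>e $ i\<close> are
  \<open>p_coeff\<close> and \<open>p'_coeff\<close>.\<close>

lemma least_square_estimator_error:
  fixes x e :: "real ^ 'n" and \<beta> :: "real ^ 2"
  assumes d: "d_coeff x \<noteq> 0"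
  shows "least_square_estimator (design_matrix x) (design_matrix x *v \<beta> + e) $ 1 =
      \<beta> $ 1 + 1 / d_coeff x * (\<Sum>i\<in>UNIV. p_coeff x $ i * e $ i)" (is ?est1)
    and "least_square_estimator (design_matrix x) (design_matrix x *v \<beta> + e) $ 2 =
      \<beta> $ 2 + 1 / d_coeff x * (\<Sum>i\<in>UNIV. p'_coeff x $ i * e $ i)" (is ?est2)
proof -
  define b where "b = least_square_estimator (design_matrix x) (design_matrix x *v \<beta> + e) - \<beta>"
  note eqs = least_square_estimator_normal_equations[OF d, of \<beta> e, folded b_def, symmetric]
  have "(\<Sum>i\<in>UNIV. p_coeff x $ i * e $ i) =
      S2 x * (\<Sum>i\<in>UNIV. e $ i) - S1 x * (\<Sum>i\<in>UNIV. x $ i * e $ i)"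
    by (simp add: p_coeff_def sum_distrib_left algebra_simps flip: sum_subtractf)
  also have "\<dots> = d_coeff x * b $ 1"
    unfolding eqs d_coeff_def by (simp add: algebra_simps power2_eq_square)
  finally show ?est1 using d by (simp add: b_def)
  have "(\<Sum>i\<in>UNIV. p'_coeff x $ i * e $ i) =
      real CARD('n) * (\<Sum>i\<in>UNIV. x $ i * e $ i) - S1 x * (\<Sum>i\<in>UNIV. e $ i)"
    by (simp add: p'_coeff_def sum_distrib_left algebra_simps flip: sum_subtractf)
  also have "\<dots> = d_coeff x * b $ 2"
    unfolding eqs d_coeff_def by (simp add: algebra_simps power2_eq_square)
  finally show ?est2 using d by (simp add: b_def)
qed

section \<open>Densities of the two components\<close>

text \<open>Affine change of variables: as \<open>d\<close> is positive, scaling by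
  \<open>1 / d\<close> contributes the factor \<open>d\<close> without an absolute value.\<close>

lemma (in prob_space) has_pdf_affine_sum_uniform:
  fixes \<epsilon> :: "'n::finite \<Rightarrow> 'a \<Rightarrow> real" and q :: "real ^ 'n"
  assumes n: "CARD('n) \<ge> 2" and \<theta>: "\<theta> > 0" and "indep_vars (\<lambda>_. borel) \<epsilon> UNIV"
    and "\<And>i. distr M borel (\<epsilon> i) = uniform_measure lborel {-\<theta>..\<theta>}"
    and q: "\<And>i. q $ i \<noteq> 0" and d: "d > 0"
  shows "has_pdf M (\<lambda>\<omega>. b + 1 / d * (\<Sum>i\<in>UNIV. q $ i * \<epsilon> i \<omega>)) (\<lambda>t. d * g_dens \<theta> q (d * (t - b)))"
proof -
  have nonneg: "0 \<le> g_dens \<theta> q w" for w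
    unfolding g_dens_eq_box_density[OF n] using q \<theta> by (intro box_density_nonneg) auto
  have "distributed M lborel (\<lambda>\<omega>. \<Sum>i\<in>UNIV. q $ i * \<epsilon> i \<omega>) (\<lambda>w. ennreal (g_dens \<theta> q w))"
    unfolding g_dens_eq_box_density[OF n] using assms by (intro distributed_sum_uniform) auto
  from distributed_affine[OF this, of "1 / d" b]
  have "distributed M lborel (\<lambda>\<omega>. b + 1 / d * (\<Sum>i\<in>UNIV. q $ i * \<epsilon> i \<omega>))
      (\<lambda>t. ennreal (g_dens \<theta> q ((t - b) / (1 / d))) / ennreal \<bar>1 / d\<bar>)"
    using d by simp
  moreover have "ennreal (g_dens \<theta> q ((t - b) / (1 / d))) / ennreal \<bar>1 / d\<bar> =
      ennreal (d * g_dens \<theta> q (d * (t - b)))" for t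
    using d nonneg by (subst divide_ennreal) (auto simp: mult.commute)
  ultimately show ?thesis
    using d nonneg by (simp add: has_pdf_def)
qed

theorem mainTheorem1:
  fixes M :: "'a measure"
    and x :: "real ^ 'n"
    and \<theta> :: real
    and \<beta> :: "real ^ 2"
    and \<epsilon> :: "'n \<Rightarrow> 'a \<Rightarrow> real"
    and Y :: "'a \<Rightarrow> real ^ 'n"
    and \<beta>hat :: "'a \<Rightarrow> real ^ 2"
  assumes "prob_space M"
    and "CARD('n) \<ge> 2"
    and "\<not> collinear {0, x, (\<chi> i. 1)}"
    and "\<theta> > 0"
    and "prob_space.indep_vars M (\<lambda>_. borel) \<epsilon> UNIV"
    and "\<And>i. distr M borel (\<epsilon> i) = uniform_measure lborel {-\<theta>..\<theta>}"
    and "\<And>\<omega>. Y \<omega> = design_matrix x *v \<beta> + (\<chi> i. \<epsilon> i \<omega>)"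
    and "\<And>\<omega>. \<beta>hat \<omega> = least_square_estimator (design_matrix x) (Y \<omega>)"
  shows "((\<forall>k. p_coeff x $ k \<noteq> 0) \<longrightarrow>
           has_pdf M (\<lambda>\<omega>. \<beta>hat \<omega> $ 1)
             (\<lambda>t. d_coeff x * g_dens \<theta> (p_coeff x) (d_coeff x * (t - \<beta> $ 1)))) \<and>
         ((\<forall>k. p'_coeff x $ k \<noteq> 0) \<longrightarrow>
           has_pdf M (\<lambda>\<omega>. \<beta>hat \<omega> $ 2)
             (\<lambda>t. d_coeff x * g_dens \<theta> (p'_coeff x) (d_coeff x * (t - \<beta> $ 2))))"
proof -
  interpret prob_space M by fact
  have d: "d_coeff x > 0" by (rule d_coeff_pos) fact
  then have d0: "d_coeff x \<noteq> 0" by simp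
  show ?thesis
    \<comment> \<open>Both components now have the same affine form, with weights
      \<open>p_coeff x\<close> and \<open>p'_coeff x\<close>.\<close>
    unfolding assms(7,8) least_square_estimator_error[OF d0]
    using has_pdf_affine_sum_uniform[OF assms(2,4,5,6) _ d] by simp
qed

end
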